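(* Let $\mathcal D=(\mathcal M,\mathcal E)$ be a MAC grid of $\Omega$. For $n\in\{1,\dots,N-1\}$, assume that $\rho^n\in L_{\mathcal M}$ satisfies $0<\rho_{\min}\le\rho^n\le\rho_{\max}$. If $\rho^{n+1}\in L_{\mathcal M}$ and $\boldsymbol u^{n+1}\in\mathbf H_{\mathcal E,0}$ satisfy, for all $K\in\mathcal M$, the discrete mass balance and divergence constraint $$\frac1{\delta t}(\rho^{n+1}_K-\rho^n_K)+\frac1{|K|}\sum_{\sigma\in\mathcal E(K)}|\sigma|\rho^{n+1}_\sigma u^{n+1}_{K,\sigma}=0,\qquad\sum_{\sigma\in\mathcal E(K)}|\sigma|u^{n+1}_{K,\sigma}=0,$$ then $$\rho_{\min}\le\rho^{n+1}\le\rho_{\max}.$$ Moreover, provided that the discrete viscosity $\mu^n=\mu(\rho^n)\in L_{\mathcal M}$ satisfies $0<\mu_{\min}\le\mu^n\le\mu_{\max}$, the discrete viscosity $\mu^{n+1}=\mu(\rho^{n+1})\in L_{\mathcal M}$ satisfies $$\mu_{\min}\le\mu^{n+1}\le\mu_{\max}.$$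
   Context: $d\in\{2,3\}$; $\Omega\subset\mathbb R^d$ is a bounded connected open set that is a finite union of rectangles ($d=2$) or rectangular parallelepipeds ($d=3$) with faces orthogonal to the canonical basis vectors $e_1,\dots,e_d$. $N\in\mathbb N$ is the number of time steps and $\delta t>0$ the time step; $\rho_{\min}$ and $\rho_{\max}$ are the essential infimum and supremum over $\Omega$ of the initial density $\rho_0\in L^\infty(\Omega)$. The viscosity law $\rho\mapsto\mu(\rho)$ is a continuous function, and for $\rho\in L_{\mathcal M}$, $\mu(\rho)=\sum_K\mu(\rho_K)\mathbf 1_K$; $\mu_{\min}$ and $\mu_{\max}$ are constants. MAC grid: $\mathcal M$ is a conforming structured (possibly non-uniform) partition of $\Omega$ into axis-parallel rectangles/parallelepipeds $K$; $\mathcal E$ is the set of faces (edges if $d=2$) $\sigma$ of the cells; $\mathcal E(K)$: faces of $K$; $\mathcal E_{\rm ext}$: faces on $\partial\Omega$; $\mathcal E^{(i)}$: faces orthogonal to $e_i$. $|\cdot|$ is $d$- or $(d-1)$-dimensional Lebesgue measure. $\sigma=K|L$: interior face common to $K$ and $L$. $n_{K,\sigma}$: unit normal to $\sigma$ outward $K$. $D_\sigma$: union of the halves, adjacent to $\sigma$, of the cell(s) having $\sigma$ as a face. $L_{\mathcal M}$: functions $q=\sum_Kq_K\mathbf 1_K$. $\mathbf H_{\mathcal E,0}$: $d$-tuples $(u_1,\dots,u_d)$ with $u_i=\sum_{\sigma\in\mathcal E^{(i)}}u_\sigma\mathbf 1_{D_\sigma}$ and $u_\sigma=0$ for $\sigma\in\mathcal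 E_{\rm ext}$. $u_{K,\sigma}=u_\sigma\,n_{K,\sigma}\cdot e_i$ for $\sigma\in\mathcal E(K)\cap\mathcal E^{(i)}$. Upwind density: for $\sigma=K|L$, $\rho_\sigma=\rho_K$ if $u_{K,\sigma}\ge0$ and $\rho_\sigma=\rho_L$ otherwise (on exterior faces the flux is zero).
   Formalization: The viscosity claim is proved under the added assumption that μ_min ≤ μ(s) ≤ μ_max for all s in [ρ_min, ρ_max]; with bounds on μ^n alone it fails for non-monotone μ. *)

theory Defs
  imports "HOL-Analysis.Analysis" "HOL-Probability.Essential_Supremum"
begin

definition essinf :: "'a measure \<Rightarrow> ('a \<Rightarrow> ereal) \<Rightarrow> ereal" where
  "essinf M f = - esssup M (\<lambda>x. - f x)"

definition L_infty_on :: "(real ^ 'd) set \<Rightarrow> (real ^ 'd \<Rightarrow> real) \<Rightarrow> bool" where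
  "L_infty_on \<Omega> f \<longleftrightarrow> f \<in> borel_measurable (lebesgue_on \<Omega>) \<and>
     (\<exists>C. AE x in lebesgue_on \<Omega>. \<bar>f x\<bar> \<le> C)"

(* An open set that is a finite union of axis-parallel boxes, whichever boundary points
   these contain, is also a finite union of open boxes. *)
definition mac_domain :: "(real ^ 'd) set \<Rightarrow> bool" where
  "mac_domain \<Omega> \<longleftrightarrow> open \<Omega> \<and> bounded \<Omega> \<and> connected \<Omega> \<and>
     (\<exists>B. finite B \<and> (\<forall>R\<in>B. \<exists>a b. R = box a b) \<and> \<Omega> = \<Union>B)"

(* Cells are closed boxes; the intersection of two cells may be empty. *)
definition conforming :: "(real ^ 'd) set set \<Rightarrow> bool" where
  "conforming M \<longleftrightarrow> (\<forall>K\<in>M. \<forall>L\<in>M. (K \<inter> L) face_of K \<and> (K \<inter> L) face_of L)"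

(* S i is the finite set of coordinates of the grid hyperplanes orthogonal to e_i; every cell
   is a product of intervals between consecutive, arbitrarily spaced, grid coordinates.
   In particular cells are non-degenerate. *)
definition structured :: "(real ^ 'd) set set \<Rightarrow> bool" where
  "structured M \<longleftrightarrow> (\<exists>S :: 'd \<Rightarrow> real set. (\<forall>i. finite (S i)) \<and>
     (\<forall>K\<in>M. \<exists>a b. K = cbox a b \<and>
        (\<forall>i. a $ i \<in> S i \<and> b $ i \<in> S i \<and> a $ i < b $ i \<and> S i \<inter> {a $ i<..<b $ i} = {})))"

definition mac_mesh :: "(real ^ 'd) set \<Rightarrow> (real ^ 'd) set set \<Rightarrow> bool" where
  "mac_mesh \<Omega> M \<longleftrightarrow> M division_of closure \<Omega> \<and> (\<forall>K\<in>M. interior K \<subseteq> \<Omega>) \<and>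
     conforming M \<and> structured M"

definition cell_faces :: "(real ^ 'd) set \<Rightarrow> (real ^ 'd) set set" where
  "cell_faces K = {\<sigma>. \<sigma> facet_of K}"

definition mesh_faces :: "(real ^ 'd) set set \<Rightarrow> (real ^ 'd) set set" where
  "mesh_faces M = (\<Union>K\<in>M. cell_faces K)"

definition exterior_faces :: "(real ^ 'd) set \<Rightarrow> (real ^ 'd) set set \<Rightarrow> (real ^ 'd) set set" where
  "exterior_faces \<Omega> M = {\<sigma> \<in> mesh_faces M. \<sigma> \<subseteq> frontier \<Omega>}"

definition orthogonal_to_axis :: "(real ^ 'd) set \<Rightarrow> 'd \<Rightarrow> bool" where
  "orthogonal_to_axis \<sigma> i \<longleftrightarrow> (\<forall>x\<in>\<sigma>. \<forall>y\<in>\<sigma>. x $ i = y $ i)"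

definition mesh_faces_dir :: "(real ^ 'd) set set \<Rightarrow> 'd \<Rightarrow> (real ^ 'd) set set" where
  "mesh_faces_dir M i = {\<sigma> \<in> mesh_faces M. orthogonal_to_axis \<sigma> i}"

(* Unique for a facet of a non-degenerate box. *)
definition face_dir :: "(real ^ 'd) set \<Rightarrow> 'd" where
  "face_dir \<sigma> = (THE i. orthogonal_to_axis \<sigma> i)"

definition cell_measure :: "(real ^ 'd) set \<Rightarrow> real" where
  "cell_measure K = measure lebesgue K"

(* The (d-1)-dimensional Lebesgue measure of a face orthogonal to e_i: the face is
   identified with a subset of the product of real lines indexed by the coordinates j \<noteq> i. *)
definition face_measure :: "(real ^ 'd) set \<Rightarrow> real" where
  "face_measure \<sigma> = (let J = - {face_dir \<sigma>} in
     measure (Pi\<^sub>M J (\<lambda>_. lborel)) ((\<lambda>x. \<lambda>j\<in>J. x $ j) ` \<sigma>))"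

definition outward_normal :: "(real ^ 'd) set \<Rightarrow> (real ^ 'd) set \<Rightarrow> real ^ 'd" where
  "outward_normal K \<sigma> = (THE \<nu>. norm \<nu> = 1 \<and> (\<forall>x\<in>\<sigma>. \<forall>y\<in>\<sigma>. \<nu> \<bullet> (y - x) = 0) \<and>
     (\<forall>x\<in>\<sigma>. \<forall>y\<in>K. \<nu> \<bullet> (y - x) \<le> 0))"

definition cell_center :: "(real ^ 'd) set \<Rightarrow> real ^ 'd" where
  "cell_center K = (1/2) *\<^sub>R (interval_lowerbound K + interval_upperbound K)"

definition half_cell :: "(real ^ 'd) set \<Rightarrow> (real ^ 'd) set \<Rightarrow> (real ^ 'd) set" where
  "half_cell K \<sigma> = {x \<in> K. 0 \<le> outward_normal K \<sigma> \<bullet> (x - cell_center K)}"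

definition dual_cell :: "(real ^ 'd) set set \<Rightarrow> (real ^ 'd) set \<Rightarrow> (real ^ 'd) set" where
  "dual_cell M \<sigma> = (\<Union>K\<in>{K \<in> M. \<sigma> \<in> cell_faces K}. half_cell K \<sigma>)"

(* Since cells (and dual cells) are closed, the functions below have their intended values
   only almost everywhere, namely off the boundaries of the (dual) cells. *)
definition cell_function :: "(real ^ 'd) set set \<Rightarrow> ((real ^ 'd) set \<Rightarrow> real) \<Rightarrow> real ^ 'd \<Rightarrow> real" where
  "cell_function M q = (\<lambda>x. \<Sum>K\<in>M. q K * indicator K x)"

definition face_function ::
    "(real ^ 'd) set set \<Rightarrow> ((real ^ 'd) set \<Rightarrow> real) \<Rightarrow> real ^ 'd \<Rightarrow> real ^ 'd" where
  "face_function M v = (\<lambda>x. \<chi> i. \<Sum>\<sigma>\<in>mesh_faces_dir M i. v \<sigma> * indicator (dual_cell M \<sigma>) x)"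

(* q lies in L_M, with cell values q_K = qv K. *)
definition in_L_mesh ::
    "(real ^ 'd) set set \<Rightarrow> (real ^ 'd \<Rightarrow> real) \<Rightarrow> ((real ^ 'd) set \<Rightarrow> real) \<Rightarrow> bool" where
  "in_L_mesh M q qv \<longleftrightarrow> q = cell_function M qv"

(* u lies in H_{E,0}, with face values u_\<sigma> = uv \<sigma>. *)
definition in_H_faces0 ::
    "(real ^ 'd) set \<Rightarrow> (real ^ 'd) set set \<Rightarrow> (real ^ 'd \<Rightarrow> real ^ 'd) \<Rightarrow> ((real ^ 'd) set \<Rightarrow> real) \<Rightarrow> bool"
  where
  "in_H_faces0 \<Omega> M u uv \<longleftrightarrow> u = face_function M uv \<and> (\<forall>\<sigma>\<in>exterior_faces \<Omega> M. uv \<sigma> = 0)"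

definition normal_velocity ::
    "((real ^ 'd) set \<Rightarrow> real) \<Rightarrow> (real ^ 'd) set \<Rightarrow> (real ^ 'd) set \<Rightarrow> real" where
  "normal_velocity uv K \<sigma> = uv \<sigma> * (outward_normal K \<sigma> \<bullet> axis (face_dir \<sigma>) 1)"

(* The cell L such that \<sigma> = K|L. *)
definition neighbour :: "(real ^ 'd) set set \<Rightarrow> (real ^ 'd) set \<Rightarrow> (real ^ 'd) set \<Rightarrow> (real ^ 'd) set" where
  "neighbour M K \<sigma> = (THE L. L \<in> M \<and> L \<noteq> K \<and> \<sigma> \<in> cell_faces L)"

(* On an exterior face the normal velocity vanishes for u in H_{E,0}: the first branch
   applies, neighbour is not used, and the corresponding flux is zero. *)
definition upwind_density ::
    "(real ^ 'd) set set \<Rightarrow> ((real ^ 'd) set \<Rightarrow> real) \<Rightarrow> ((real ^ 'd) set \<Rightarrow> real) \<Rightarrow>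
     (real ^ 'd) set \<Rightarrow> (real ^ 'd) set \<Rightarrow> real" where
  "upwind_density M rv uv K \<sigma> =
     (if 0 \<le> normal_velocity uv K \<sigma> then rv K else rv (neighbour M K \<sigma>))"

definition discrete_mass_balance ::
    "(real ^ 'd) set set \<Rightarrow> real \<Rightarrow> ((real ^ 'd) set \<Rightarrow> real) \<Rightarrow> ((real ^ 'd) set \<Rightarrow> real) \<Rightarrow>
     ((real ^ 'd) set \<Rightarrow> real) \<Rightarrow> bool" where
  "discrete_mass_balance M \<delta>t r_old r_new uv \<longleftrightarrow> (\<forall>K\<in>M.
     1 / \<delta>t * (r_new K - r_old K) + 1 / cell_measure K *
       (\<Sum>\<sigma>\<in>cell_faces K. face_measure \<sigma> * upwind_density M r_new uv K \<sigma> * normal_velocity uv K \<sigma>) = 0)"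

definition discrete_divergence_free ::
    "(real ^ 'd) set set \<Rightarrow> ((real ^ 'd) set \<Rightarrow> real) \<Rightarrow> bool" where
  "discrete_divergence_free M uv \<longleftrightarrow> (\<forall>K\<in>M.
     (\<Sum>\<sigma>\<in>cell_faces K. face_measure \<sigma> * normal_velocity uv K \<sigma>) = 0)"

(* \<mu>(q) for q in L_M with cell values qv. *)
definition discrete_viscosity ::
    "(real ^ 'd) set set \<Rightarrow> (real \<Rightarrow> real) \<Rightarrow> ((real ^ 'd) set \<Rightarrow> real) \<Rightarrow> real ^ 'd \<Rightarrow> real" where
  "discrete_viscosity M \<mu> qv = cell_function M (\<lambda>K. \<mu> (qv K))"

definition bounds_ae :: "(real ^ 'd) set \<Rightarrow> real \<Rightarrow> (real ^ 'd \<Rightarrow> real) \<Rightarrow> real \<Rightarrow> bool" where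
  "bounds_ae \<Omega> a f b \<longleftrightarrow> (AE x in lebesgue_on \<Omega>. a \<le> f x \<and> f x \<le> b)"

end

theory Submission
  imports Defs
begin

text \<open>
  By the divergence constraint, the mass balance in a cell \<open>K\<close> reads
  \<open>\<rho>\<^sub>K\<^sup>n\<^sup>+\<^sup>1 - \<rho>\<^sub>K\<^sup>n = - (\<delta>t / |K|) \<Sum>\<^sub>\<sigma> |\<sigma>| (\<rho>\<^sub>\<sigma> - \<rho>\<^sub>K\<^sup>n\<^sup>+\<^sup>1) u\<^sub>K\<^sub>,\<^sub>\<sigma>\<close>, where upwinding leaves only the
  faces with \<open>u\<^sub>K\<^sub>,\<^sub>\<sigma> < 0\<close>, on which \<open>\<rho>\<^sub>\<sigma>\<close> is the new density of the neighbour. In a cell where the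
  new density is maximal every summand is thus nonnegative, so the maximum cannot increase; the
  minimum is treated in the same way. Geometrically, this needs that a face not contained in the
  boundary of the domain belongs to exactly one other cell: there is another cell because a point
  of the relative interior of the face can be left through the face without leaving the domain,
  and only one because two full-dimensional convex sets on the same side of a common facet overlap.
\<close>

section \<open>Facets of convex sets\<close>

lemma convex_interior_Int_nonempty:
  fixes S T :: "'a :: euclidean_space set"
  assumes "convex T" "interior T \<noteq> {}" "interior S \<inter> T \<noteq> {}"
  shows "interior S \<inter> interior T \<noteq> {}"
proof -
  have "T \<subseteq> closure (interior T)"
    using assms by (simp add: convex_closure_interior closure_subset)
  then have "interior S \<inter> closure (interior T) \<noteq> {}"
    using assms by blast
  then show ?thesis
    by (simp add: open_Int_closure_eq_empty)
qed

lemma facet_of_disjoint_interior: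
  assumes "F facet_of S" shows "F \<inter> interior S = {}"
proof (rule face_of_disjoint_interior)
  show "F face_of S" using assms by (simp add: facet_of_def)
  show "F \<noteq> S" using assms by (auto simp: facet_of_def)
qed

text \<open>Moving from a relative interior point \<open>y\<close> of \<open>F\<close> slightly
  towards \<open>w\<close> stays in the interior of \<open>S\<close>. The point reached is also a
  convex combination of \<open>z\<close> and a point of \<open>F\<close> near \<open>y\<close>,
  hence lies in \<open>T\<close>.\<close>

lemma same_side_interiors_meet:
  fixes S T F :: "'a :: euclidean_space set"
  assumes S: "convex S" "F \<subseteq> S" and T: "convex T" "F \<subseteq> T" and F: "convex F" "F \<noteq> {}"
    and hull: "affine hull F = {x. a \<bullet> x = b}"
    and w: "w \<in> interior S" "a \<bullet> w < b" and z: "z \<in> interior T" "a \<bullet> z < b"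
  shows "interior S \<inter> interior T \<noteq> {}"
proof -
  obtain y where y: "y \<in> rel_interior F"
    using F rel_interior_eq_empty by blast
  then have "y \<in> F" and ay: "a \<bullet> y = b"
    using rel_interior_subset hull hull_subset[of F affine] by blast+
  \<comment> \<open>\<open>t\<close> is the ratio of the distances of \<open>w\<close> and
    \<open>z\<close> to the hyperplane. Thus \<open>w - y\<close> and
    \<open>t *\<^sub>R (z - y)\<close> have the same normal component, and their difference
    \<open>h\<close> is parallel to the hyperplane.\<close>
  define t where "t = (b - a \<bullet> w) / (b - a \<bullet> z)"
  have "t > 0" using w z by (simp add: t_def)
  define h where "h = (w - y) - t *\<^sub>R (z - y)"
  have "a \<bullet> h = 0"
  proof -
    have "t * (b - a \<bullet> z) = b - a \<bullet> w" using z by (simp add: t_def)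
    then show ?thesis by (simp add: h_def inner_diff_right ay algebra_simps)
  qed
  then have "y - h \<in> affine hull F"
    by (simp add: hull inner_diff_right ay)
  \<comment> \<open>The segment from \<open>y - h\<close> to \<open>y\<close> can be prolonged
    inside \<open>F\<close> beyond \<open>y\<close>; its new end is
    \<open>y + (e - 1) *\<^sub>R h\<close>.\<close>
  then obtain e where "e > 1" and e: "(1 - e) *\<^sub>R (y - h) + e *\<^sub>R y \<in> F"
    using convex_rel_interior_iff2[OF F] y by blast
  \<comment> \<open>The bound \<open>e - 1\<close> keeps \<open>y + d *\<^sub>R h\<close> between
    \<open>y\<close> and the end of the prolonged segment; the bound 1 makes \<open>c * d\<close> an
    admissible shrinking factor below.\<close>
  define d where "d = min 1 (e - 1)"
  have d: "d > 0" "d \<le> 1" "d \<le> e - 1" using \<open>e > 1\<close> by (auto simp: d_def)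
  have "y + d *\<^sub>R h = (1 - d / (e - 1)) *\<^sub>R y + (d / (e - 1)) *\<^sub>R ((1 - e) *\<^sub>R (y - h) + e *\<^sub>R y)"
  proof -
    have *: "(1 - e) *\<^sub>R (y - h) + e *\<^sub>R y = y + (e - 1) *\<^sub>R h"
      by (simp add: algebra_simps)
    have "(d / (e - 1)) *\<^sub>R ((e - 1) *\<^sub>R h) = d *\<^sub>R h" using \<open>e > 1\<close> by simp
    then show ?thesis unfolding * scaleR_add_right by (simp add: scaleR_diff_left)
  qed
  also have "\<dots> \<in> F"
    using F d \<open>e > 1\<close> by (intro convexD_alt[OF _ \<open>y \<in> F\<close> e]) (auto simp: field_simps)
  finally have yd: "y + d *\<^sub>R h \<in> T" using T by blast
  \<comment> \<open>Normalisation making \<open>c\<close> and \<open>c * d * t\<close> the weights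
    of a convex combination.\<close>
  define c where "c = 1 / (1 + d * t)"
  have c: "c > 0" "c < 1" "c + c * d * t = 1"
  proof -
    have "d * t > 0" using d \<open>t > 0\<close> by simp
    then show "c > 0" "c < 1" "c + c * d * t = 1"
      by (simp_all add: c_def add_divide_distrib[symmetric])
  qed
  have q: "y - (c * d) *\<^sub>R (y - w) = c *\<^sub>R (y + d *\<^sub>R h) + (c * d * t) *\<^sub>R z"
  proof -
    have "c *\<^sub>R (y + d *\<^sub>R h) + (c * d * t) *\<^sub>R z
        = (c + c * d * t) *\<^sub>R y - (c * d) *\<^sub>R (y - w)"
      by (simp add: h_def algebra_simps)
    then show ?thesis by (simp add: c)
  qed
  have "y - (c * d) *\<^sub>R (y - w) \<in> interior S"
    using \<open>y \<in> F\<close> S w c d by (intro mem_interior_convex_shrink) (auto simp: mult_le_one)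
  moreover have "y - (c * d) *\<^sub>R (y - w) \<in> T"
    unfolding q using T z interior_subset c d \<open>t > 0\<close> yd
    by (intro convexD[OF T(1) yd]) auto
  ultimately show ?thesis
    using T z by (intro convex_interior_Int_nonempty) auto
qed

text \<open>Pigeonhole: the affine hull of \<open>F\<close> is a hyperplane with only two sides.
  \<open>B\<close> and \<open>C\<close> must both lie opposite to \<open>A\<close>, hence on the
  same side, where they overlap.\<close>

lemma three_cells_common_facet:
  fixes A B C F :: "'a :: euclidean_space set"
  assumes conv: "convex A" "convex B" "convex C"
    and ne: "interior A \<noteq> {}" "interior B \<noteq> {}" "interior C \<noteq> {}"
    and facet: "F facet_of A" "F facet_of B" "F facet_of C"
    and disj: "interior A \<inter> interior B = {}" "interior A \<inter> interior C = {}"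
  shows "interior B \<inter> interior C \<noteq> {}"
proof -
  have F: "convex F" "F \<noteq> {}" "F \<subseteq> A" "F \<subseteq> B" "F \<subseteq> C"
    using facet by (auto simp: facet_of_def intro: face_of_imp_convex dest: face_of_imp_subset)
  have "aff_dim F = DIM('a) - 1"
    using facet ne by (simp add: facet_of_def aff_dim_nonempty_interior)
  then obtain a b where hull: "affine hull F = {x. a \<bullet> x = b}"
    using aff_dim_eq_hyperplane by blast
  \<comment> \<open>The reversed normal lets the same lemma treat the side
    \<open>a \<bullet> x > b\<close>.\<close>
  then have hull': "affine hull F = {x. (- a) \<bullet> x = - b}" by auto
  \<comment> \<open>A face is the intersection of the convex set with the affine hull of the face,
    so an interior point on the hyperplane would belong to the facet.\<close>
  have off: "a \<bullet> x \<noteq> b" if "convex X" "F facet_of X" "x \<in> interior X" for X x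
  proof
    assume "a \<bullet> x = b"
    then have "x \<in> affine hull F \<inter> X" using hull that interior_subset by auto
    then have "x \<in> F"
      using face_of_imp_eq_affine_Int[OF \<open>convex X\<close>] that by (auto simp: facet_of_def)
    then show False using facet_of_disjoint_interior that by blast
  qed
  obtain p q s where pts: "p \<in> interior A" "q \<in> interior B" "s \<in> interior C" using ne by blast
  have sides: "a \<bullet> p \<noteq> b" "a \<bullet> q \<noteq> b" "a \<bullet> s \<noteq> b"
    using off pts conv facet by blast+
  have meet: "interior X \<inter> interior Y \<noteq> {}"
    if "convex X" "convex Y" "F \<subseteq> X" "F \<subseteq> Y" "x \<in> interior X" "y \<in> interior Y"
      "a \<bullet> x < b \<and> a \<bullet> y < b \<or> a \<bullet> x > b \<and> a \<bullet> y > b" for X Y x y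
    using same_side_interiors_meet[OF that(1,3,2,4) F(1,2) hull that(5) _ that(6)]
      same_side_interiors_meet[OF that(1,3,2,4) F(1,2) hull' that(5) _ that(6)] that(7)
    by auto
  have "\<not> (a \<bullet> p < b \<and> a \<bullet> q < b \<or> a \<bullet> p > b \<and> a \<bullet> q > b)"
    using meet[of A B p q] conv F pts disj by blast
  moreover have "\<not> (a \<bullet> p < b \<and> a \<bullet> s < b \<or> a \<bullet> p > b \<and> a \<bullet> s > b)"
    using meet[of A C p s] conv F pts disj by blast
  ultimately have "a \<bullet> q < b \<and> a \<bullet> s < b \<or> a \<bullet> q > b \<and> a \<bullet> s > b"
    using sides by linarith
  then show ?thesis using meet[of B C q s] conv F pts by blast
qed

section \<open>Cells and faces of a MAC mesh\<close>

context
  fixes \<Omega> :: "(real ^ 'd) set" and M :: "(real ^ 'd) set set"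
  assumes mesh: "mac_mesh \<Omega> M"
begin

lemma mesh_division: "M division_of closure \<Omega>"
  using mesh unfolding mac_mesh_def by blast

lemmas mesh_finite = division_ofD(1)[OF mesh_division]
  and mesh_Union = division_ofD(6)[OF mesh_division]

lemma mesh_cell:
  assumes "K \<in> M"
  shows "convex K" "closed K" "interior K \<noteq> {}" "interior K \<subseteq> \<Omega>"
proof -
  obtain a b where K: "K = cbox a b" and "\<And>i. a $ i < b $ i"
    using mesh assms unfolding mac_mesh_def structured_def by metis
  then have "box a b \<noteq> {}" by (simp add: interval_ne_empty_cart)
  then show "convex K" "closed K" "interior K \<noteq> {}" by (simp_all add: K closed_cbox)
  show "interior K \<subseteq> \<Omega>" using mesh assms by (auto simp: mac_mesh_def)
qed

lemma mesh_interior_disjoint: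
  assumes "K \<in> M" "L \<in> M" "K \<noteq> L"
  shows "interior K \<inter> interior L = {}"
  using division_ofD(5)[OF mesh_division assms] .

lemma mesh_interior_unique:
  assumes "K \<in> M" "L \<in> M" "x \<in> interior K" "x \<in> L"
  shows "L = K"
proof (rule ccontr)
  assume "L \<noteq> K"
  then have "interior K \<inter> interior L = {}" using mesh_interior_disjoint assms(1,2) by blast
  moreover have "interior K \<inter> L \<noteq> {}" using assms(3,4) by blast
  ultimately show False
    using convex_interior_Int_nonempty[OF mesh_cell(1,3)[OF assms(2)]] by blast
qed

lemma cell_function_interior:
  assumes "K \<in> M" "x \<in> interior K"
  shows "cell_function M q x = q K"
proof -
  have "cell_function M q x = (\<Sum>L\<in>M. if L = K then q L else 0)"
    unfolding cell_function_def
  proof (rule sum.cong[OF refl])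
    fix L assume "L \<in> M"
    then have "x \<in> L \<longleftrightarrow> L = K"
      using mesh_interior_unique[OF assms(1) _ assms(2)] assms(2) interior_subset by blast
    then show "q L * indicator L x = (if L = K then q L else 0)"
      by (simp add: indicator_def)
  qed
  then show ?thesis using mesh_finite assms by simp
qed

text \<open>A bound violated in one cell is violated on its whole interior, a nonempty open subset
  of the domain and so not negligible. Conversely, the overlaps of closed cells lie in the finitely
  many cell frontiers, which are negligible. This reduces the theorem to cell values.\<close>

lemma bounds_ae_cell_function_iff:
  assumes "open \<Omega>"
  shows "bounds_ae \<Omega> a (cell_function M q) b \<longleftrightarrow> (\<forall>K\<in>M. a \<le> q K \<and> q K \<le> b)"
proof -
  have AE_iff: "(AE x in lebesgue_on \<Omega>. P x) \<longleftrightarrow> (AE x in lebesgue. x \<in> \<Omega> \<longrightarrow> P x)" for P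
    using assms by (intro AE_restrict_space_iff) auto
  show ?thesis
  proof
    assume L: "bounds_ae \<Omega> a (cell_function M q) b"
    show "\<forall>K\<in>M. a \<le> q K \<and> q K \<le> b"
    proof (rule ballI, rule ccontr)
      fix K assume K: "K \<in> M" and bad: "\<not> (a \<le> q K \<and> q K \<le> b)"
      have "AE x in lebesgue. x \<notin> interior K"
        using L unfolding bounds_ae_def AE_iff
      proof eventually_elim
        case (elim x)
        then show ?case
          using bad mesh_cell(4)[OF K] cell_function_interior[OF K] by auto
      qed
      then have "negligible (interior K)"
        using AE_iff_null_sets[of "interior K" lebesgue] by (simp add: negligible_iff_null_sets)
      then show False using open_not_negligible mesh_cell(3)[OF K] by blast
    qed
  next
    assume R: "\<forall>K\<in>M. a \<le> q K \<and> q K \<le> b"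
    have "negligible (\<Union>K\<in>M. frontier K)"
      using mesh_finite by (auto intro!: negligible_convex_frontier mesh_cell)
    then have "AE x in lebesgue. x \<notin> (\<Union>K\<in>M. frontier K)"
      by (intro AE_not_in) (simp add: negligible_iff_null_sets)
    then show "bounds_ae \<Omega> a (cell_function M q) b"
      unfolding bounds_ae_def AE_iff
    proof eventually_elim
      case (elim x)
      show ?case
      proof
        assume "x \<in> \<Omega>"
        then obtain K where K: "K \<in> M" "x \<in> K"
          using mesh_Union closure_subset by blast
        then have "x \<in> interior K"
          using elim closure_subset by (auto simp: frontier_def)
        then show "a \<le> cell_function M q x \<and> cell_function M q x \<le> b"
          using cell_function_interior K R by auto
      qed
    qed
  qed
qed

text \<open>A ray from the interior of \<open>K\<close> through a relative interior point of the
  face leaves \<open>K\<close> while still in the domain, and so enters another cell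
  \<open>L\<close>. Conformity and a dimension count then identify the face with
  \<open>K \<inter> L\<close>.\<close>

lemma neighbour_exists:
  assumes "open \<Omega>" "K \<in> M" and \<sigma>: "\<sigma> facet_of K" and inner: "\<not> \<sigma> \<subseteq> frontier \<Omega>"
  shows "\<exists>L. L \<in> M \<and> L \<noteq> K \<and> \<sigma> facet_of L"
proof -
  have conv: "convex \<sigma>" "\<sigma> \<subseteq> K"
    using \<sigma> by (auto simp: facet_of_def intro: face_of_imp_convex dest: face_of_imp_subset)
  have "\<sigma> \<subseteq> closure \<Omega>" using conv \<open>K \<in> M\<close> mesh_Union by blast
  then have "\<Omega> \<inter> \<sigma> \<noteq> {}"
    using inner \<open>open \<Omega>\<close> by (auto simp: frontier_def interior_open)
  \<comment> \<open>An open set meeting a convex set also meets its relative interior.\<close>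
  then have "\<Omega> \<inter> closure (rel_interior \<sigma>) \<noteq> {}"
    using convex_closure_rel_interior[OF conv(1)] closure_subset by blast
  then obtain y where y: "y \<in> \<Omega>" "y \<in> rel_interior \<sigma>"
    using open_Int_closure_eq_empty[OF \<open>open \<Omega>\<close>] by blast
  then have "y \<in> \<sigma>" using rel_interior_subset by blast
  obtain w where w: "w \<in> interior K" using mesh_cell(3)[OF \<open>K \<in> M\<close>] by blast
  \<comment> \<open>Discarding the finitely many closed cells that miss \<open>y\<close> leaves a
    neighbourhood of \<open>y\<close> in which every point lies only in cells containing
    \<open>y\<close>.\<close>
  define U where "U = \<Omega> - \<Union>{L \<in> M. y \<notin> L}"
  have "closed (\<Union>{L \<in> M. y \<notin> L})"
    using mesh_finite mesh_cell by (intro closed_Union) auto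
  then have "open U" "y \<in> U" using \<open>open \<Omega>\<close> y by (auto simp: U_def)
  have "((\<lambda>e. y + e *\<^sub>R (y - w)) \<longlongrightarrow> y + 0 *\<^sub>R (y - w)) (at_right 0)"
    by (intro tendsto_intros)
  then have "eventually (\<lambda>e. y + e *\<^sub>R (y - w) \<in> U) (at_right 0)"
    using topological_tendstoD \<open>open U\<close> \<open>y \<in> U\<close> by fastforce
  then have "eventually (\<lambda>e. y + e *\<^sub>R (y - w) \<in> U \<and> e > 0) (at_right (0::real))"
    using eventually_at_right_less by (rule eventually_conj)
  then obtain e :: real where e: "y + e *\<^sub>R (y - w) \<in> U" "e > 0"
    using eventually_happens trivial_limit_at_right_real by blast
  define x where "x = y + e *\<^sub>R (y - w)"
  have "x \<in> closure \<Omega>" using e closure_subset by (auto simp: x_def U_def)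
  then obtain L where L: "L \<in> M" "x \<in> L" using mesh_Union by blast
  then have "y \<in> L" using e by (auto simp: x_def U_def)
  have "x \<notin> K"
  proof
    assume "x \<in> K"
    \<comment> \<open>\<open>y\<close> divides the segment from \<open>x\<close> to \<open>w\<close>
      at the fraction \<open>e / (1 + e)\<close>; with \<open>x\<close> in \<open>K\<close>, this
      would put \<open>y\<close> in the interior of \<open>K\<close>.\<close>
    have "x - (e / (1 + e)) *\<^sub>R (x - w) \<in> interior K" if "e > 0"
      using that mesh_cell(1)[OF \<open>K \<in> M\<close>] \<open>x \<in> K\<close> w
      by (intro mem_interior_convex_shrink) auto
    moreover have "x - (e / (1 + e)) *\<^sub>R (x - w) = y"
    proof -
      have "x - w = (1 + e) *\<^sub>R (y - w)" by (simp add: x_def algebra_simps)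
      then show ?thesis using \<open>e > 0\<close> by (simp add: x_def)
    qed
    ultimately show False
      using \<open>e > 0\<close> facet_of_disjoint_interior[OF \<sigma>] \<open>y \<in> \<sigma>\<close> by auto
  qed
  then have "L \<noteq> K" using L by blast
  have faces: "(K \<inter> L) face_of K" "(K \<inter> L) face_of L"
    using mesh \<open>K \<in> M\<close> L by (auto simp: mac_mesh_def conforming_def)
  have "\<sigma> \<subseteq> K \<inter> L"
    using \<open>y \<in> L\<close> \<open>y \<in> \<sigma>\<close> y conv by (intro subset_of_face_of[OF faces(1)]) auto
  have "K \<inter> L \<noteq> K"
    using mesh_interior_unique[OF \<open>K \<in> M\<close> L(1) w] w interior_subset \<open>L \<noteq> K\<close> by blast
  \<comment> \<open>\<open>K \<inter> L\<close> has dimension at most that of \<open>K\<close> minus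
    one, already attained by its face \<open>\<sigma>\<close>. A proper face would have strictly
    smaller dimension, so the two coincide.\<close>
  then have "aff_dim (K \<inter> L) < aff_dim K"
    using faces mesh_cell \<open>K \<in> M\<close> face_of_aff_dim_lt by blast
  moreover have "aff_dim \<sigma> = aff_dim K - 1" using \<sigma> by (simp add: facet_of_def)
  moreover have "\<sigma> face_of (K \<inter> L)"
    using \<sigma> \<open>\<sigma> \<subseteq> K \<inter> L\<close> face_of_subset[of \<sigma> K "K \<inter> L"] by (simp add: facet_of_def)
  ultimately have "\<sigma> = K \<inter> L"
    using face_of_aff_dim_lt[of "K \<inter> L" \<sigma>] face_of_imp_convex[OF faces(1)] by fastforce
  moreover have "aff_dim K = aff_dim L"
    using mesh_cell(3) \<open>K \<in> M\<close> L by (simp add: aff_dim_nonempty_interior)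
  ultimately have "\<sigma> facet_of L"
    using \<sigma> faces by (simp add: facet_of_def)
  then show ?thesis using L \<open>L \<noteq> K\<close> by blast
qed

text \<open>\<open>neighbour\<close> is a definite description, so it is meaningful only once the
  second cell is unique: two candidates would share the facet with \<open>K\<close>, and their
  interiors would meet.\<close>

lemma neighbour_in_mesh:
  assumes "open \<Omega>" "K \<in> M" "\<sigma> \<in> cell_faces K" "\<sigma> \<notin> exterior_faces \<Omega> M"
  shows "neighbour M K \<sigma> \<in> M"
proof -
  have \<sigma>: "\<sigma> facet_of K" "\<not> \<sigma> \<subseteq> frontier \<Omega>"
    using assms by (auto simp: cell_faces_def exterior_faces_def mesh_faces_def)
  obtain L where L: "L \<in> M" "L \<noteq> K" "\<sigma> facet_of L"
    using neighbour_exists[OF assms(1,2) \<sigma>] by blast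
  have unique: "L' = L" if L': "L' \<in> M" "L' \<noteq> K" "\<sigma> facet_of L'" for L'
  proof (rule ccontr)
    assume "L' \<noteq> L"
    then have "interior L \<inter> interior L' = {}"
      using mesh_interior_disjoint[OF L(1) L'(1)] by simp
    moreover have "interior L \<inter> interior L' \<noteq> {}"
      by (rule three_cells_common_facet[OF mesh_cell(1)[OF assms(2)] mesh_cell(1)[OF L(1)]
        mesh_cell(1)[OF L'(1)] mesh_cell(3)[OF assms(2)] mesh_cell(3)[OF L(1)]
        mesh_cell(3)[OF L'(1)] \<sigma>(1) L(3) L'(3)
        mesh_interior_disjoint[OF assms(2) L(1) L(2)[symmetric]]
        mesh_interior_disjoint[OF assms(2) L'(1) L'(2)[symmetric]]])
    ultimately show False by contradiction
  qed
  have "neighbour M K \<sigma> = L"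
    unfolding neighbour_def cell_faces_def mem_Collect_eq
  proof (rule the_equality)
    show "L \<in> M \<and> L \<noteq> K \<and> \<sigma> facet_of L" using L by (intro conjI)
    show "L' = L" if "L' \<in> M \<and> L' \<noteq> K \<and> \<sigma> facet_of L'" for L'
      using unique that by (elim conjE)
  qed
  with L(1) show ?thesis by (simp only:)
qed

section \<open>The discrete maximum principle\<close>

lemma upwind_increment:
  assumes "discrete_mass_balance M \<delta>t r r' uv" "discrete_divergence_free M uv" "\<delta>t \<noteq> 0" "K \<in> M"
  shows "r' K - r K = - (\<delta>t / cell_measure K) * (\<Sum>\<sigma>\<in>cell_faces K.
    face_measure \<sigma> * ((upwind_density M r' uv K \<sigma> - r' K) * normal_velocity uv K \<sigma>))"
proof -
  have "(\<Sum>\<sigma>\<in>cell_faces K. face_measure \<sigma> * ((upwind_density M r' uv K \<sigma> - r' K) * normal_velocity uv K \<sigma>))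
     = (\<Sum>\<sigma>\<in>cell_faces K. face_measure \<sigma> * upwind_density M r' uv K \<sigma> * normal_velocity uv K \<sigma>)
       - r' K * (\<Sum>\<sigma>\<in>cell_faces K. face_measure \<sigma> * normal_velocity uv K \<sigma>)"
    unfolding sum_distrib_left sum_subtractf[symmetric]
    by (intro sum.cong refl) (simp add: algebra_simps)
  also have "\<dots> = (\<Sum>\<sigma>\<in>cell_faces K. face_measure \<sigma> * upwind_density M r' uv K \<sigma> * normal_velocity uv K \<sigma>)"
    using assms by (simp add: discrete_divergence_free_def)
  finally have "1 / \<delta>t * (r' K - r K) + 1 / cell_measure K * (\<Sum>\<sigma>\<in>cell_faces K.
      face_measure \<sigma> * ((upwind_density M r' uv K \<sigma> - r' K) * normal_velocity uv K \<sigma>)) = 0"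
    using assms by (simp add: discrete_mass_balance_def)
  then have "1 / \<delta>t * (r' K - r K) = - (1 / cell_measure K * (\<Sum>\<sigma>\<in>cell_faces K.
      face_measure \<sigma> * ((upwind_density M r' uv K \<sigma> - r' K) * normal_velocity uv K \<sigma>)))"
    by (rule add_eq_0_iff2[THEN iffD1])
  from arg_cong[OF this, of "(*) \<delta>t"] show ?thesis
    using \<open>\<delta>t \<noteq> 0\<close> by simp
qed

text \<open>Where the normal velocity is nonnegative, upwinding selects \<open>r K\<close> and the
  term vanishes. A negative normal velocity excludes exterior faces, so the upwind value belongs to
  a genuine cell and extremality of \<open>r K\<close> fixes the sign.\<close>

lemma
  assumes "open \<Omega>" and ext: "\<forall>\<sigma>\<in>exterior_faces \<Omega> M. uv \<sigma> = 0"
    and K: "K \<in> M" "\<sigma> \<in> cell_faces K"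
  shows upwind_flux_nonneg: "(\<And>L. L \<in> M \<Longrightarrow> r L \<le> r K) \<Longrightarrow>
      0 \<le> (upwind_density M r uv K \<sigma> - r K) * normal_velocity uv K \<sigma>"
    and upwind_flux_nonpos: "(\<And>L. L \<in> M \<Longrightarrow> r K \<le> r L) \<Longrightarrow>
      (upwind_density M r uv K \<sigma> - r K) * normal_velocity uv K \<sigma> \<le> 0"
proof -
  have inflow: "neighbour M K \<sigma> \<in> M" if "normal_velocity uv K \<sigma> < 0"
  proof -
    have "uv \<sigma> \<noteq> 0" using that by (auto simp: normal_velocity_def)
    then show ?thesis using neighbour_in_mesh[OF \<open>open \<Omega>\<close> K] ext by blast
  qed
  show "0 \<le> (upwind_density M r uv K \<sigma> - r K) * normal_velocity uv K \<sigma>"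
    if "\<And>L. L \<in> M \<Longrightarrow> r L \<le> r K"
    using inflow that by (auto simp: upwind_density_def intro: mult_nonpos_nonpos)
  show "(upwind_density M r uv K \<sigma> - r K) * normal_velocity uv K \<sigma> \<le> 0"
    if "\<And>L. L \<in> M \<Longrightarrow> r K \<le> r L"
    using inflow that by (auto simp: upwind_density_def intro: mult_nonneg_nonpos)
qed

lemma upwind_maximum_principle:
  assumes "open \<Omega>" and ext: "\<forall>\<sigma>\<in>exterior_faces \<Omega> M. uv \<sigma> = 0"
    and step: "discrete_mass_balance M \<delta>t r r' uv" "discrete_divergence_free M uv" "0 < \<delta>t"
    and old: "\<And>K. K \<in> M \<Longrightarrow> a \<le> r K \<and> r K \<le> b"
    and "K \<in> M"
  shows "a \<le> r' K \<and> r' K \<le> b"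
proof
  have coeff: "0 \<le> \<delta>t / cell_measure L" for L :: "(real ^ 'd) set"
    using step(3) by (simp add: cell_measure_def)
  have face: "0 \<le> face_measure \<sigma>" for \<sigma> :: "(real ^ 'd) set"
    by (simp add: face_measure_def Let_def)
  note increment = upwind_increment[OF step(1,2) less_imp_neq[OF step(3), symmetric]]
  have ne: "M \<noteq> {}" using \<open>K \<in> M\<close> by blast
  \<comment> \<open>Finiteness of the mesh provides an extremal cell \<open>L\<close>. The chain
    \<open>r' K \<le> r' L \<le> r L \<le> b\<close>, and its mirror image for the minimum, carries
    the bound to every \<open>K\<close>.\<close>
  have "Max (r' ` M) \<in> r' ` M" using mesh_finite ne by simp
  then obtain L where "L \<in> M" "r' L = Max (r' ` M)" by auto
  then have L: "L \<in> M" "\<And>L'. L' \<in> M \<Longrightarrow> r' L' \<le> r' L"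
    using mesh_finite by simp_all
  have "0 \<le> (\<Sum>\<sigma>\<in>cell_faces L. face_measure \<sigma> *
      ((upwind_density M r' uv L \<sigma> - r' L) * normal_velocity uv L \<sigma>))"
    using upwind_flux_nonneg[OF assms(1) ext L(1), where r = r'] L(2)
    by (intro sum_nonneg mult_nonneg_nonneg[OF face]) blast
  then have "r' L - r L \<le> 0"
    unfolding increment[OF L(1)] using coeff[of L] by (intro mult_nonpos_nonneg) simp_all
  then show "r' K \<le> b" using L(2)[OF \<open>K \<in> M\<close>] old[OF L(1)] by linarith
  have "Min (r' ` M) \<in> r' ` M" using mesh_finite ne by simp
  then obtain L where "L \<in> M" "r' L = Min (r' ` M)" by auto
  then have L: "L \<in> M" "\<And>L'. L' \<in> M \<Longrightarrow> r' L \<le> r' L'"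
    using mesh_finite by simp_all
  have "(\<Sum>\<sigma>\<in>cell_faces L. face_measure \<sigma> *
      ((upwind_density M r' uv L \<sigma> - r' L) * normal_velocity uv L \<sigma>)) \<le> 0"
    using upwind_flux_nonpos[OF assms(1) ext L(1), where r = r'] L(2)
    by (intro sum_nonpos mult_nonneg_nonpos[OF face]) blast
  then have "0 \<le> r' L - r L"
    unfolding increment[OF L(1)] using coeff[of L] by (intro mult_nonpos_nonpos) simp_all
  then show "a \<le> r' K" using L(2)[OF \<open>K \<in> M\<close>] old[OF L(1)] by linarith
qed

end

theorem lemma5p1:
  fixes \<Omega> :: "(real ^ 'd) set" and M :: "(real ^ 'd) set set"
    and N n :: nat and \<delta>t \<rho>min \<rho>max \<mu>min \<mu>max :: real
    and \<rho>0 :: "real ^ 'd \<Rightarrow> real" and \<mu> :: "real \<Rightarrow> real"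
    and \<rho> :: "nat \<Rightarrow> real ^ 'd \<Rightarrow> real" and r :: "nat \<Rightarrow> (real ^ 'd) set \<Rightarrow> real"
    and u :: "nat \<Rightarrow> real ^ 'd \<Rightarrow> real ^ 'd" and v :: "nat \<Rightarrow> (real ^ 'd) set \<Rightarrow> real"
  assumes dim: "CARD('d) \<in> {2, 3}"
    and domain: "mac_domain \<Omega>"
    and mesh: "mac_mesh \<Omega> M"
    and step: "0 < \<delta>t" "n \<in> {1..N - 1}"
    and initial: "L_infty_on \<Omega> \<rho>0"
      "ereal \<rho>min = essinf (lebesgue_on \<Omega>) (\<lambda>x. ereal (\<rho>0 x))"
      "ereal \<rho>max = esssup (lebesgue_on \<Omega>) (\<lambda>x. ereal (\<rho>0 x))"
    and viscosity: "continuous_on {\<rho>min..\<rho>max} \<mu>"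
    and old: "in_L_mesh M (\<rho> n) (r n)" "0 < \<rho>min" "bounds_ae \<Omega> \<rho>min (\<rho> n) \<rho>max"
    and new: "in_L_mesh M (\<rho> (n + 1)) (r (n + 1))" "in_H_faces0 \<Omega> M (u (n + 1)) (v (n + 1))"
    and mass: "discrete_mass_balance M \<delta>t (r n) (r (n + 1)) (v (n + 1))"
    and div: "discrete_divergence_free M (v (n + 1))"
  shows "bounds_ae \<Omega> \<rho>min (\<rho> (n + 1)) \<rho>max \<and>
    ((\<forall>s\<in>{\<rho>min..\<rho>max}. \<mu>min \<le> \<mu> s \<and> \<mu> s \<le> \<mu>max) \<longrightarrow>
     0 < \<mu>min \<longrightarrow>
     bounds_ae \<Omega> \<mu>min (discrete_viscosity M \<mu> (r n)) \<mu>max \<longrightarrow>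
     bounds_ae \<Omega> \<mu>min (discrete_viscosity M \<mu> (r (n + 1))) \<mu>max)"
proof -
  have "open \<Omega>" using domain by (simp add: mac_domain_def)
  note bounds_iff = bounds_ae_cell_function_iff[OF mesh this]
  have "\<rho>min \<le> r n K \<and> r n K \<le> \<rho>max" if "K \<in> M" for K
    using old that by (simp add: in_L_mesh_def bounds_iff)
  then have "\<forall>K\<in>M. \<rho>min \<le> r (n + 1) K \<and> r (n + 1) K \<le> \<rho>max"
    using upwind_maximum_principle[OF mesh \<open>open \<Omega>\<close> _ mass div step(1)] new(2)
    unfolding in_H_faces0_def by blast
  \<comment> \<open>The new cell densities need not occur among the old ones; their viscosities are
    controlled because \<open>\<mu>\<close> is bounded on the whole interval from
    \<open>\<rho>min\<close> to \<open>\<rho>max\<close>.\<close>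
  then show ?thesis
    using new by (simp add: in_L_mesh_def discrete_viscosity_def bounds_iff)
qed

end
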